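(* Suppose that $f$ is $l_f$-smooth and coercive (that is, $\lim_{\|w\|\to\infty}f(w)=\infty$), that $A$ is full row rank with $\gamma:=\sqrt{\theta_{\min}(AA^\top)}>0$, and that for the given $\mu>0$ the parameters satisfy $$\rho>\max\left\{\frac{16(c_1^2+c_2^2)}{\mu},\frac{6l_f}{\gamma^2}\right\},\quad \alpha=\frac1\rho,\quad \beta:=\frac{8c_2^2}{\rho},\quad \eta>\frac{4}{\rho\gamma^2},\quad \frac{\epsilon_{k+1}}{\epsilon_k}\le\sqrt{\frac{\rho\gamma^2\eta-4}{\rho\gamma^2\eta+4}}\ \ \forall k,$$ where $c_1:=(\mu+l_f)/\gamma$ and $c_2:=\mu/\gamma$. Let $\{(w^k;u^k;z^k;v^k)\}_{k\in\mathbb{N}}$ be a sequence generated by IALM satisfying the stopping criteria (a) and (b). Then $\{(w^k;u^k;z^k;v^k)\}_{k\in\mathbb{N}}$ is bounded.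
   Context: Setting: $f:\mathbb{R}^p\to\mathbb{R}$ is continuously differentiable, $A\in\mathbb{R}^{n\times p}$, $b\in\mathbb{R}^n$, $\lambda,\rho,\mu>0$. A function is $l$-smooth if its gradient is Lipschitz continuous with constant $l$; $\theta_{\min}$ is the smallest eigenvalue. For $u\in\mathbb{R}^n$, $u_+:=(\max\{0,u_i\})_i$ and $\|u\|_0$ counts nonzero components. $(w;u)$ denotes concatenation; $\|x\|_P^2:=x^\top Px$; ${\rm dist}(u,\Theta):=\inf_{\theta\in\Theta}\|u-\theta\|$. Lyapunov function: $\mathcal{V}_{\rho,\mu}(w,u,z,v):=f(w)+\lambda\|u_+\|_0+\langle z,Aw+b-u\rangle+\frac{\rho}{2}\|Aw+b-u\|^2+\frac{\mu}{2}\|w-v\|^2$. Proximal operator (set-valued): ${\rm Prox}_{\alpha\lambda\|(\cdot)_+\|_0}(z):=\arg\min_{u\in\mathbb{R}^n}\ \lambda\|u_+\|_0+\frac{1}{2\alpha}\|u-z\|^2$. IALM (inexact augmented Lagrangian method): given a positive sequence $\{\epsilon_k\}_{k\in\mathbb{N}}$, fixed $\mu>0$, $\rho>0$, $\alpha=1/\rho$, start with any $(w^0;u^0;z^0;v^0)\in\mathbb{R}^p\times\mathbb{R}^n\times\mathbb{R}^n\times\mathbb{R}^p$. With $h_k(w,u):=f(w)+\frac{\mu}{2}\|w-v^k\|^2+\langle z^k,Aw+b-u\rangle+\frac{\rho}{2}\|Aw+b-u\|^2$, for $k=0,1,\dots$: Primal step: use the inner solver 0/1-BALM to compute $(w^{k+1};u^{k+1})$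 as an approximate solution of $\min_{w,u}\mathcal{V}_{\rho,\mu}(w,u,z^k,v^k)$ satisfying the stopping criteria (a) $\mathcal{V}_{\rho,\mu}(w^{k+1},u^{k+1},z^k,v^k)\le\mathcal{V}_{\rho,\mu}(w^k,u^k,z^k,v^k)$, (b) $\max\big\{{\rm dist}\big(u^{k+1},{\rm Prox}_{\alpha\lambda\|(\cdot)_+\|_0}(u^{k+1}-\alpha\nabla_uh_k(w^{k+1},u^{k+1}))\big),\ \|\nabla_wh_k(w^{k+1},u^{k+1})\|\big\}\le\epsilon_k$. Multiplier step: $z^{k+1}=z^k+\rho(Aw^{k+1}+b-u^{k+1})$. Lyapunov step: $v^{k+1}=w^{k+1}$. Inner solver 0/1-BALM: let $t>0$, $Q_{k,j}$ symmetric positive semidefinite, $P_{k,j}:=tI-Q_{k,j}$, $g:\mathbb{R}^p\to\mathbb{R}$ $l_g$-smooth, $\psi_{k,j}(w):=\frac12\|w\|_{P_{k,j}}^2-g(w)$, and $\mathcal{D}_{\psi_{k,j}}(w,w^{k,j}):=\psi_{k,j}(w)-\psi_{k,j}(w^{k,j})-\langle\nabla\psi_{k,j}(w^{k,j}),w-w^{k,j}\rangle$. Starting from $(w^{k,0};u^{k,0})=(w^k;u^k)$, for $j=0,1,\dots$ take $u^{k,j+1}\in{\rm Prox}_{\alpha\lambda\|(\cdot)_+\|_0}(u^{k,j}-\alpha\nabla_uh_k(w^{k,j},u^{k,j}))$ and $w^{k,j+1}\in\arg\min_w h_k(w,u^{k,j+1})+\mathcal{D}_{\psi_{k,j}}(w,w^{k,j})$;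 $(w^{k+1};u^{k+1})$ is an iterate satisfying (a) and (b). *)

theory Defs
  imports "HOL-Analysis.Analysis"
begin

text \<open>Only meaningful at points where \<open>f\<close> is differentiable (there the gradient exists and is unique).\<close>
definition grad :: "('a::euclidean_space \<Rightarrow> real) \<Rightarrow> 'a \<Rightarrow> 'a" where
  "grad f x = (THE D. GDERIV f x :> D)"

definition cont_diff :: "('a::euclidean_space \<Rightarrow> real) \<Rightarrow> bool" where
  "cont_diff f \<longleftrightarrow> (\<forall>x. f differentiable (at x)) \<and> continuous_on UNIV (grad f)"

definition l_smooth :: "real \<Rightarrow> ('a::euclidean_space \<Rightarrow> real) \<Rightarrow> bool" where
  "l_smooth l f \<longleftrightarrow> (\<forall>x. f differentiable (at x)) \<and> lipschitz_on l UNIV (grad f)"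

definition coercive :: "('a::euclidean_space \<Rightarrow> real) \<Rightarrow> bool" where
  "coercive f \<longleftrightarrow> filterlim f at_top at_infinity"

definition is_eigenvalue :: "real^'n^'n \<Rightarrow> real \<Rightarrow> bool" where
  "is_eigenvalue M c \<longleftrightarrow> (\<exists>x. x \<noteq> 0 \<and> M *v x = c *\<^sub>R x)"

text \<open>Intended for symmetric matrices, which have a nonempty finite set of real eigenvalues.\<close>
definition theta_min :: "real^'n^'n \<Rightarrow> real" where
  "theta_min M = (LEAST c. is_eigenvalue M c)"

definition sym_psd :: "real^'n^'n \<Rightarrow> bool" where
  "sym_psd M \<longleftrightarrow> transpose M = M \<and> (\<forall>x. 0 \<le> x \<bullet> (M *v x))"

definition pos_part :: "real^'n \<Rightarrow> real^'n" where
  "pos_part u = (\<chi> i. max 0 (u $ i))"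

definition l0_norm :: "real^'n \<Rightarrow> real" where
  "l0_norm u = real (card {i. u $ i \<noteq> 0})"

text \<open>The set-valued proximal operator of \<open>\<alpha> \<lambda> \<parallel>(\<cdot>)\<^sub>+\<parallel>\<^sub>0\<close>.\<close>
definition prox :: "real \<Rightarrow> real \<Rightarrow> real^'n \<Rightarrow> (real^'n) set" where
  "prox \<alpha> lam z =
     {u. is_arg_min (\<lambda>u. lam * l0_norm (pos_part u) + 1 / (2 * \<alpha>) * (norm (u - z))\<^sup>2) (\<lambda>_. True) u}"

text \<open>
  In the following definitions \<open>z\<close> is the multiplier and \<open>v\<close> the proximal centre
  (\<open>z\<^sup>k\<close> and \<open>v\<^sup>k\<close> in the \<open>k\<close>-th outer iteration).
\<close>

definition lyapunov ::
  "(real^'p \<Rightarrow> real) \<Rightarrow> real^'p^'n \<Rightarrow> real^'n \<Rightarrow> real \<Rightarrow> real \<Rightarrow> real \<Rightarrow>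
   real^'p \<Rightarrow> real^'n \<Rightarrow> real^'n \<Rightarrow> real^'p \<Rightarrow> real" where
  "lyapunov f A b lam \<rho> \<mu> w u z v =
     f w + lam * l0_norm (pos_part u) + z \<bullet> (A *v w + b - u)
       + \<rho> / 2 * (norm (A *v w + b - u))\<^sup>2 + \<mu> / 2 * (norm (w - v))\<^sup>2"

definition h_fun ::
  "(real^'p \<Rightarrow> real) \<Rightarrow> real^'p^'n \<Rightarrow> real^'n \<Rightarrow> real \<Rightarrow> real \<Rightarrow>
   real^'n \<Rightarrow> real^'p \<Rightarrow> real^'p \<Rightarrow> real^'n \<Rightarrow> real" where
  "h_fun f A b \<rho> \<mu> z v w u =
     f w + \<mu> / 2 * (norm (w - v))\<^sup>2 + z \<bullet> (A *v w + b - u)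
       + \<rho> / 2 * (norm (A *v w + b - u))\<^sup>2"

definition grad_w_h ::
  "(real^'p \<Rightarrow> real) \<Rightarrow> real^'p^'n \<Rightarrow> real^'n \<Rightarrow> real \<Rightarrow> real \<Rightarrow>
   real^'n \<Rightarrow> real^'p \<Rightarrow> real^'p \<Rightarrow> real^'n \<Rightarrow> real^'p" where
  "grad_w_h f A b \<rho> \<mu> z v w u = grad (\<lambda>w'. h_fun f A b \<rho> \<mu> z v w' u) w"

definition grad_u_h ::
  "(real^'p \<Rightarrow> real) \<Rightarrow> real^'p^'n \<Rightarrow> real^'n \<Rightarrow> real \<Rightarrow> real \<Rightarrow>
   real^'n \<Rightarrow> real^'p \<Rightarrow> real^'p \<Rightarrow> real^'n \<Rightarrow> real^'n" where
  "grad_u_h f A b \<rho> \<mu> z v w u = grad (\<lambda>u'. h_fun f A b \<rho> \<mu> z v w u') u"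

definition psi_fun :: "real \<Rightarrow> real^'p^'p \<Rightarrow> (real^'p \<Rightarrow> real) \<Rightarrow> real^'p \<Rightarrow> real" where
  "psi_fun t Q g w = 1 / 2 * (w \<bullet> ((t *\<^sub>R mat 1 - Q) *v w)) - g w"

definition bregman :: "('a::euclidean_space \<Rightarrow> real) \<Rightarrow> 'a \<Rightarrow> 'a \<Rightarrow> real" where
  "bregman \<psi> w w' = \<psi> w - \<psi> w' - grad \<psi> w' \<bullet> (w - w')"

text \<open>
  A run of the inner solver 0/1-BALM with inner iterates \<open>(wi j; ui j)\<close>, \<open>j = 0, \<dots>, J\<close>,
  started from \<open>(w0; u0)\<close>.
\<close>
definition balm_run ::
  "(real^'p \<Rightarrow> real) \<Rightarrow> real^'p^'n \<Rightarrow> real^'n \<Rightarrow> real \<Rightarrow> real \<Rightarrow> real \<Rightarrow> real \<Rightarrow>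
   real \<Rightarrow> (nat \<Rightarrow> real^'p^'p) \<Rightarrow> (real^'p \<Rightarrow> real) \<Rightarrow>
   real^'n \<Rightarrow> real^'p \<Rightarrow> real^'p \<Rightarrow> real^'n \<Rightarrow> nat \<Rightarrow>
   (nat \<Rightarrow> real^'p) \<Rightarrow> (nat \<Rightarrow> real^'n) \<Rightarrow> bool" where
  "balm_run f A b lam \<rho> \<mu> \<alpha> t Q g z v w0 u0 J wi ui \<longleftrightarrow>
     wi 0 = w0 \<and> ui 0 = u0 \<and>
     (\<forall>j<J.
        ui (Suc j) \<in> prox \<alpha> lam (ui j - \<alpha> *\<^sub>R grad_u_h f A b \<rho> \<mu> z v (wi j) (ui j)) \<and>
        is_arg_min (\<lambda>w. h_fun f A b \<rho> \<mu> z v w (ui (Suc j)) + bregman (psi_fun t (Q j) g) w (wi j))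
          (\<lambda>_. True) (wi (Suc j)))"

definition stop_a ::
  "(real^'p \<Rightarrow> real) \<Rightarrow> real^'p^'n \<Rightarrow> real^'n \<Rightarrow> real \<Rightarrow> real \<Rightarrow> real \<Rightarrow>
   real^'n \<Rightarrow> real^'p \<Rightarrow> real^'p \<Rightarrow> real^'n \<Rightarrow> real^'p \<Rightarrow> real^'n \<Rightarrow> bool" where
  "stop_a f A b lam \<rho> \<mu> z v w u w' u' \<longleftrightarrow>
     lyapunov f A b lam \<rho> \<mu> w' u' z v \<le> lyapunov f A b lam \<rho> \<mu> w u z v"

definition stop_b ::
  "(real^'p \<Rightarrow> real) \<Rightarrow> real^'p^'n \<Rightarrow> real^'n \<Rightarrow> real \<Rightarrow> real \<Rightarrow> real \<Rightarrow> real \<Rightarrow> real \<Rightarrow>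
   real^'n \<Rightarrow> real^'p \<Rightarrow> real^'p \<Rightarrow> real^'n \<Rightarrow> bool" where
  "stop_b f A b lam \<rho> \<mu> \<alpha> \<epsilon> z v w' u' \<longleftrightarrow>
     max (infdist u' (prox \<alpha> lam (u' - \<alpha> *\<^sub>R grad_u_h f A b \<rho> \<mu> z v w' u')))
         (norm (grad_w_h f A b \<rho> \<mu> z v w' u')) \<le> \<epsilon>"

definition ialm_sequence ::
  "(real^'p \<Rightarrow> real) \<Rightarrow> real^'p^'n \<Rightarrow> real^'n \<Rightarrow> real \<Rightarrow> real \<Rightarrow> real \<Rightarrow> real \<Rightarrow> (nat \<Rightarrow> real) \<Rightarrow>
   real \<Rightarrow> (nat \<Rightarrow> nat \<Rightarrow> real^'p^'p) \<Rightarrow> (real^'p \<Rightarrow> real) \<Rightarrow>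
   (nat \<Rightarrow> real^'p) \<Rightarrow> (nat \<Rightarrow> real^'n) \<Rightarrow> (nat \<Rightarrow> real^'n) \<Rightarrow> (nat \<Rightarrow> real^'p) \<Rightarrow> bool" where
  "ialm_sequence f A b lam \<rho> \<mu> \<alpha> \<epsilon> t Q g w u z v \<longleftrightarrow>
     (\<forall>k.
        (\<exists>J wi ui. balm_run f A b lam \<rho> \<mu> \<alpha> t (Q k) g (z k) (v k) (w k) (u k) J wi ui \<and>
                   w (Suc k) = wi J \<and> u (Suc k) = ui J) \<and>
        stop_a f A b lam \<rho> \<mu> (z k) (v k) (w k) (u k) (w (Suc k)) (u (Suc k)) \<and>
        stop_b f A b lam \<rho> \<mu> \<alpha> (\<epsilon> k) (z k) (v k) (w (Suc k)) (u (Suc k)) \<and>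
        z (Suc k) = z k + \<rho> *\<^sub>R (A *v w (Suc k) + b - u (Suc k)) \<and>
        v (Suc k) = w (Suc k))"

end

theory Submission
  imports Defs
begin

text \<open>
  Write \<open>d\<^sub>k = w\<^sub>k\<^sub>+\<^sub>1 - v\<^sub>k\<close>, a step of the primal sequence for \<open>k \<ge> 1\<close>. The gradient of \<open>h\<^sub>k\<close> in \<open>w\<close>
  contains the multiplier and the penalty only through \<open>A\<^sup>T(z\<^sub>k + \<rho>(Aw + b - u))\<close>, and at the new iterate the multiplier
  step turns this into \<open>A\<^sup>Tz\<^sub>k\<^sub>+\<^sub>1\<close>. Stopping criterion (b) therefore determines the multiplier up to an
  error \<open>e\<^sub>k\<close> of norm at most \<open>\<epsilon>\<^sub>k\<close>: \<open>A\<^sup>Tz\<^sub>k\<^sub>+\<^sub>1 = e\<^sub>k - \<nabla>f(w\<^sub>k\<^sub>+\<^sub>1) - \<mu>d\<^sub>k\<close>. Since \<open>\<gamma>\<^sup>2\<close>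
  is the least eigenvalue of \<open>AA\<^sup>T\<close>, one has \<open>\<gamma>\<parallel>y\<parallel> \<le> \<parallel>A\<^sup>Ty\<parallel>\<close> (\<open>norm_transpose_mult_ge\<close>), and \<open>\<gamma> > 0\<close>. So
  the identity controls both the increments and the size of the multipliers.

  Increments: by criterion (a) the primal step does not raise the Lyapunov function. The multiplier step raises the Lyapunov function by \<open>\<parallel>z\<^sub>k\<^sub>+\<^sub>1 - z\<^sub>k\<parallel>\<^sup>2/\<rho>\<close>, and moving the
  proximal centre lowers it by \<open>\<mu>/2 \<parallel>d\<^sub>k\<parallel>\<^sup>2\<close> (\<open>lyapunov_multiplier_step\<close>). By
  \<open>multiplier_increment_le\<close> the increase is bounded by multiples of \<open>\<parallel>d\<^sub>k\<parallel>\<^sup>2\<close>, \<open>\<parallel>d\<^sub>k\<^sub>-\<^sub>1\<parallel>\<^sup>2\<close>, \<open>\<epsilon>\<^sub>k\<^sup>2\<close> and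
  \<open>\<epsilon>\<^sub>k\<^sub>-\<^sub>1\<^sup>2\<close>. A correction \<open>\<beta>/2 \<parallel>d\<^sub>k\<parallel>\<^sup>2\<close> added to the Lyapunov function provides for the second in the next
  iteration; because \<open>\<rho>\<close> is large, the decrease \<open>\<mu>/2 \<parallel>d\<^sub>k\<parallel>\<^sup>2\<close> covers it and the first; and the ratio
  condition on the tolerances makes the last two telescope against \<open>\<eta>\<epsilon>\<^sub>k\<^sup>2\<close>
  (\<open>tolerance_step_le\<close>). Hence the Lyapunov function plus these two corrections never increases.

  Size: the Lyapunov function is at least \<open>f(w) - \<parallel>z\<parallel>\<^sup>2/(2\<rho>)\<close>. Again by the identity, \<open>\<parallel>z\<parallel>\<close> is bounded
  through \<open>\<epsilon>\<^sub>k\<close>, \<open>\<parallel>d\<^sub>k\<parallel>\<close> and \<open>\<parallel>\<nabla>f(w)\<parallel>\<close>. The corrections pay for the first two, and for a smooth function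
  bounded below by \<open>m\<close> the square of the gradient is at most a multiple of \<open>f(w) - m\<close>
  (\<open>l_smooth_grad_norm_le\<close>). The bound \<open>\<rho> > 6l\<^sub>f/\<gamma>\<^sup>2\<close> is what makes that term cost no more than
  half of \<open>f(w) - m\<close>. So \<open>f(w\<^sub>k)\<close> is bounded above, and \<open>w\<^sub>k\<close> is bounded by coercivity. The remaining
  sequences follow: \<open>v\<^sub>k\<close> is \<open>w\<^sub>k\<close> from \<open>k = 1\<close> on, \<open>z\<^sub>k\<close> by the identity, and \<open>u\<^sub>k\<close> by solving the
  multiplier step for it.
\<close>

text \<open>The products with \<open>A\<^sup>T\<close> below are kept as matrix-vector products, whose linearity lemmas
  the default rewriting to vector-matrix products would block.\<close>

declare transpose_matrix_vector [simp del]

section \<open>Gradients of smooth functions\<close>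

lemma has_derivative_grad:
  fixes f :: "'a::euclidean_space \<Rightarrow> real"
  assumes "f differentiable (at x)"
  shows "(f has_derivative (\<lambda>h. h \<bullet> grad f x)) (at x)"
proof -
  obtain f' where f': "(f has_derivative f') (at x)"
    using assms by (auto simp: differentiable_def)
  interpret f': bounded_linear f' using f' by (rule has_derivative_bounded_linear)
  define D where "D = (\<Sum>b\<in>Basis. f' b *\<^sub>R b)"
  have "f' h = h \<bullet> D" for h
  proof -
    have "f' h = f' (\<Sum>b\<in>Basis. (h \<bullet> b) *\<^sub>R b)" by (simp add: euclidean_representation)
    also have "\<dots> = (\<Sum>b\<in>Basis. (h \<bullet> b) * f' b)" by (simp add: f'.sum f'.scaleR)
    also have "\<dots> = h \<bullet> D" by (simp add: D_def inner_sum_right mult.commute)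
    finally show ?thesis .
  qed
  then have "f' = (\<lambda>h. h \<bullet> D)" by blast
  then have D: "GDERIV f x :> D" using f' by (simp add: gderiv_def)
  have "GDERIV f x :> grad f x"
    unfolding grad_def
  proof (rule theI[of _ D])
    fix D' assume "GDERIV f x :> D'"
    then have "(\<lambda>h. h \<bullet> D') = (\<lambda>h. h \<bullet> D)"
      using D has_derivative_unique by (auto simp: gderiv_def)
    then show "D' = D" by (metis inner_commute vector_eq_ldot)
  qed (rule D)
  then show ?thesis by (simp add: gderiv_def)
qed

lemma grad_eqI:
  fixes f :: "'a::euclidean_space \<Rightarrow> real"
  assumes "(f has_derivative (\<lambda>h. h \<bullet> D)) (at x)"
  shows "grad f x = D"
proof -
  have "f differentiable (at x)" using assms by (auto simp: differentiable_def)
  from has_derivative_unique[OF assms has_derivative_grad[OF this]]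
  show ?thesis by (metis inner_commute vector_eq_ldot)
qed

lemma l_smooth_mono: "l_smooth l f \<Longrightarrow> l \<le> l' \<Longrightarrow> l_smooth l' f"
  by (auto simp: l_smooth_def intro: lipschitz_on_le)

text \<open>The function \<open>f\<close> minus its quadratic majorant has, along the segment from \<open>x\<close> to
  \<open>x + d\<close>, a derivative that the Lipschitz bound on the gradient makes nonpositive.\<close>

lemma l_smooth_descent:
  fixes f :: "'a::euclidean_space \<Rightarrow> real"
  assumes "l_smooth l f"
  shows "f (x + d) \<le> f x + d \<bullet> grad f x + l / 2 * (norm d)\<^sup>2"
proof -
  define \<phi> where "\<phi> s = f (x + s *\<^sub>R d) - s * (d \<bullet> grad f x) - l / 2 * s\<^sup>2 * (norm d)\<^sup>2" for s :: real
  have der: "(\<phi> has_real_derivative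
      d \<bullet> (grad f (x + s *\<^sub>R d) - grad f x) - l * s * (norm d)\<^sup>2) (at s)" for s
  proof -
    have f': "(f has_derivative (\<lambda>h. h \<bullet> grad f (x + s *\<^sub>R d))) (at (x + s *\<^sub>R d))"
      using assms by (simp add: l_smooth_def has_derivative_grad)
    have "((\<lambda>s. f (x + s *\<^sub>R d)) has_derivative (\<lambda>r. (r *\<^sub>R d) \<bullet> grad f (x + s *\<^sub>R d))) (at s)"
      by (rule has_derivative_compose[where f = "\<lambda>s. x + s *\<^sub>R d" and g = f, OF _ f'])
        (auto intro!: derivative_eq_intros)
    then have "((\<lambda>s. f (x + s *\<^sub>R d)) has_real_derivative d \<bullet> grad f (x + s *\<^sub>R d)) (at s)"
      by (rule has_derivative_imp_has_field_derivative) (simp add: mult.commute)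
    then show ?thesis unfolding \<phi>_def
      by (auto intro!: derivative_eq_intros simp: inner_diff_right algebra_simps)
  qed
  have "\<phi> 1 \<le> \<phi> 0"
  proof (rule DERIV_nonpos_imp_nonincreasing[where f = \<phi>])
    fix s :: real assume s: "0 \<le> s" "s \<le> 1"
    have "norm (grad f (x + s *\<^sub>R d) - grad f x) \<le> l * (s * norm d)"
      using assms s lipschitz_onD[of l UNIV "grad f" "x + s *\<^sub>R d" x]
      by (simp add: l_smooth_def dist_norm)
    then have "norm d * norm (grad f (x + s *\<^sub>R d) - grad f x) \<le> norm d * (l * (s * norm d))"
      by (rule mult_left_mono) simp
    with norm_cauchy_schwarz[of d "grad f (x + s *\<^sub>R d) - grad f x"]
    have "d \<bullet> (grad f (x + s *\<^sub>R d) - grad f x) - l * s * (norm d)\<^sup>2 \<le> 0"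
      by (simp add: power2_eq_square algebra_simps)
    with der show "\<exists>y. (\<phi> has_real_derivative y) (at s) \<and> y \<le> 0" by blast
  qed simp
  then show ?thesis by (simp add: \<phi>_def)
qed

text \<open>A gradient step of length \<open>1 / l\<close> decreases \<open>f\<close> by at least \<open>\<parallel>\<nabla>f\<parallel>\<^sup>2 / (2 l)\<close>, but not below
  \<open>m\<close>.\<close>

lemma l_smooth_grad_norm_le:
  fixes f :: "'a::euclidean_space \<Rightarrow> real"
  assumes "l_smooth l f" "l > 0" "\<And>y. m \<le> f y"
  shows "(norm (grad f x))\<^sup>2 \<le> 2 * l * (f x - m)"
proof -
  have "m \<le> f (x + (- (1 / l)) *\<^sub>R grad f x)" by (rule assms(3))
  also have "\<dots> \<le> f x + (- (1 / l)) *\<^sub>R grad f x \<bullet> grad f x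
      + l / 2 * (norm ((- (1 / l)) *\<^sub>R grad f x))\<^sup>2"
    by (rule l_smooth_descent[OF assms(1)])
  also have "\<dots> = f x - (norm (grad f x))\<^sup>2 / (2 * l)"
    unfolding power2_norm_eq_inner using assms(2) by (simp add: field_simps)
  finally show ?thesis using assms(2) by (simp add: field_simps)
qed

section \<open>Coercive functions\<close>

lemma coercive_bounded_sublevel:
  assumes "coercive f"
  shows "bounded {x. f x \<le> c}"
proof -
  have "eventually (\<lambda>x. c + 1 \<le> f x) at_infinity"
    using assms by (simp add: coercive_def filterlim_at_top)
  then obtain r where r: "\<And>x. norm x \<ge> r \<Longrightarrow> c + 1 \<le> f x"
    by (auto simp: eventually_at_infinity)
  show ?thesis
  proof (rule boundedI)
    fix x assume "x \<in> {x. f x \<le> c}"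
    then show "norm x \<le> r" using r[of x] by (cases "norm x \<ge> r") auto
  qed
qed

lemma coercive_bounded_below:
  fixes f :: "'a::euclidean_space \<Rightarrow> real"
  assumes "coercive f" "continuous_on UNIV f"
  obtains m where "\<And>x. m \<le> f x"
proof -
  let ?S = "{x. f x \<le> f 0}"
  have "closed ?S"
    by (rule closed_Collect_le) (use assms in auto)
  then have "compact ?S"
    using coercive_bounded_sublevel[OF assms(1)] by (simp add: compact_eq_bounded_closed)
  moreover have "?S \<noteq> {}" by blast
  moreover have "continuous_on ?S f" using assms(2) continuous_on_subset by blast
  ultimately obtain x0 where "x0 \<in> ?S" "\<And>x. x \<in> ?S \<Longrightarrow> f x0 \<le> f x"
    using continuous_attains_inf by metis
  then have "f x0 \<le> f x" for x by (cases "f x \<le> f 0") (simp, force)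
  then show thesis by (rule that)
qed

section \<open>The smallest eigenvalue of a symmetric matrix\<close>

text \<open>With \<open>y = N x\<close>, the quadratic form on the line \<open>x + s y\<close> is \<open>2 s \<parallel>y\<parallel>\<^sup>2 + s\<^sup>2 c\<close>; were \<open>y\<close>
  nonzero, it would be negative for small negative \<open>s\<close>.\<close>

lemma psd_null_vector:
  fixes N :: "real^'n^'n"
  assumes sym: "transpose N = N" and psd: "\<And>y. 0 \<le> y \<bullet> (N *v y)" and x: "x \<bullet> (N *v x) = 0"
  shows "N *v x = 0"
proof -
  define y where "y = N *v x"
  define a where "a = y \<bullet> y"
  define c where "c = y \<bullet> (N *v y)"
  have adj: "x \<bullet> (N *v y) = y \<bullet> y"
    by (metis dot_lmul_matrix sym transpose_matrix_vector y_def)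
  have q: "0 \<le> 2 * s * a + s\<^sup>2 * c" for s
  proof -
    have "(x + s *\<^sub>R y) \<bullet> (N *v (x + s *\<^sub>R y)) = 2 * s * a + s\<^sup>2 * c"
      using x adj
      by (simp add: matrix_vector_right_distrib matrix_vector_mult_scaleR inner_add_left
          inner_add_right a_def c_def y_def[symmetric] power2_eq_square algebra_simps)
    then show ?thesis by (metis psd)
  qed
  have a0: "0 \<le> a" and c0: "0 \<le> c" by (simp_all add: a_def c_def psd)
  have "a = 0"
  proof (cases "c = 0")
    case True then show ?thesis using q[of "-1"] a0 by simp
  next
    case False
    then have "0 \<le> - (a\<^sup>2 / c)" using q[of "- a / c"] by (simp add: power2_eq_square field_simps)
    then show ?thesis using False c0 by (simp add: field_simps)
  qed
  then show ?thesis by (simp add: a_def y_def)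
qed

text \<open>The quadratic form attains its minimum \<open>m\<close> over the unit sphere. The minimizer is a null vector
  of the semidefinite form of \<open>M - m I\<close>, hence an eigenvector, and evaluating the form at any other
  eigenvector shows that no eigenvalue lies below \<open>m\<close>. In particular the least eigenvalue exists.\<close>

lemma theta_min_le_rayleigh:
  fixes M :: "real^'n^'n"
  assumes sym: "transpose M = M"
  shows "theta_min M * (norm x)\<^sup>2 \<le> x \<bullet> (M *v x)"
proof -
  have "continuous_on (sphere 0 1) (\<lambda>x. x \<bullet> (M *v x))"
    by (intro continuous_intros linear_continuous_on) auto
  moreover have "sphere (0::real^'n) 1 \<noteq> {}" by simp
  ultimately have "\<exists>x\<in>sphere 0 1. \<forall>y\<in>sphere 0 1. x \<bullet> (M *v x) \<le> y \<bullet> (M *v y)"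
    by (intro continuous_attains_inf compact_sphere)
  then obtain x0 where x0: "x0 \<in> sphere 0 1"
    and min: "\<And>y. y \<in> sphere 0 1 \<Longrightarrow> x0 \<bullet> (M *v x0) \<le> y \<bullet> (M *v y)"
    by blast
  define m where "m = x0 \<bullet> (M *v x0)"
  have ray: "m * (norm y)\<^sup>2 \<le> y \<bullet> (M *v y)" for y
  proof (cases "y = 0")
    case False
    then have "m \<le> (y /\<^sub>R norm y) \<bullet> (M *v (y /\<^sub>R norm y))"
      unfolding m_def by (intro min) simp
    also have "\<dots> = (y \<bullet> (M *v y)) / (norm y)\<^sup>2"
      by (simp add: matrix_vector_mult_scaleR power2_eq_square field_simps)
    finally show ?thesis using False by (simp add: field_simps)
  qed simp
  define N where "N = M - m *\<^sub>R mat 1"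
  have Nv: "N *v y = M *v y - m *\<^sub>R y" for y
    by (simp add: N_def matrix_vector_mult_diff_rdistrib scaleR_matrix_vector_assoc[symmetric])
  have "transpose N = N" using sym
    by (simp add: N_def transpose_def vec_eq_iff mat_def)
  then have "N *v x0 = 0"
    by (rule psd_null_vector)
      (use ray x0 in \<open>auto simp: Nv inner_diff_right power2_norm_eq_inner m_def[symmetric] norm_eq_1\<close>)
  then have "is_eigenvalue M m"
    using x0 by (auto simp: is_eigenvalue_def Nv intro!: exI[of _ x0])
  moreover have "m \<le> c" if ev: "is_eigenvalue M c" for c
  proof -
    obtain y where y: "y \<noteq> 0" "M *v y = c *\<^sub>R y" using ev by (auto simp: is_eigenvalue_def)
    then have "m * (norm y)\<^sup>2 \<le> c * (norm y)\<^sup>2"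
      using ray[of y] by (simp add: power2_norm_eq_inner)
    then show ?thesis using y by simp
  qed
  ultimately have "theta_min M = m" unfolding theta_min_def by (rule Least_equality)
  then show ?thesis using ray by simp
qed

lemma norm_transpose_mult_ge:
  fixes A :: "real^'p^'n"
  assumes "\<gamma> = sqrt (theta_min (A ** transpose A))" "\<gamma> > 0"
  shows "\<gamma> * norm z \<le> norm (transpose A *v z)"
proof -
  let ?M = "A ** transpose A"
  have "theta_min ?M * (norm z)\<^sup>2 \<le> z \<bullet> (?M *v z)"
    by (rule theta_min_le_rayleigh) (simp add: matrix_transpose_mul)
  also have "\<dots> = z \<bullet> (A *v (transpose A *v z))"
    by (simp add: matrix_vector_mul_assoc)
  also have "\<dots> = (norm (transpose A *v z))\<^sup>2"
    by (simp add: transpose_matrix_vector dot_lmul_matrix power2_norm_eq_inner)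
  finally have "(\<gamma> * norm z)\<^sup>2 \<le> (norm (transpose A *v z))\<^sup>2"
    using assms by (simp add: power_mult_distrib)
  then show ?thesis by (rule power2_le_imp_le) simp
qed

section \<open>Effect of one outer iteration\<close>

text \<open>The argument of \<open>A\<^sup>T\<close> is the multiplier after the multiplier step at \<open>(w; u)\<close>.\<close>

lemma grad_w_h_eq:
  fixes A :: "real^'p^'n"
  assumes "f differentiable (at w)"
  shows "grad_w_h f A b \<rho> \<mu> z v w u =
    grad f w + \<mu> *\<^sub>R (w - v) + transpose A *v (z + \<rho> *\<^sub>R (A *v w + b - u))"
proof -
  let ?r = "A *v w + b - u"
  have A': "((\<lambda>w. A *v w) has_derivative (\<lambda>h. A *v h)) (at w)"
    by (rule bounded_linear_imp_has_derivative) simp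
  have adj: "(A *v h) \<bullet> y = h \<bullet> (transpose A *v y)" for h y
    by (metis dot_lmul_matrix inner_commute transpose_matrix_vector)
  have "(h_fun f A b \<rho> \<mu> z v) = (\<lambda>w u. f w + \<mu> / 2 * ((w - v) \<bullet> (w - v)) + z \<bullet> (A *v w + b - u)
       + \<rho> / 2 * ((A *v w + b - u) \<bullet> (A *v w + b - u)))"
    by (simp add: h_fun_def power2_norm_eq_inner fun_eq_iff)
  moreover have "((\<lambda>w. f w + \<mu> / 2 * ((w - v) \<bullet> (w - v)) + z \<bullet> (A *v w + b - u)
       + \<rho> / 2 * ((A *v w + b - u) \<bullet> (A *v w + b - u))) has_derivative
      (\<lambda>h. h \<bullet> (grad f w + \<mu> *\<^sub>R (w - v) + transpose A *v (z + \<rho> *\<^sub>R ?r)))) (at w)"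
  proof -
    have "((\<lambda>w. f w + \<mu> / 2 * ((w - v) \<bullet> (w - v)) + z \<bullet> (A *v w + b - u)
       + \<rho> / 2 * ((A *v w + b - u) \<bullet> (A *v w + b - u))) has_derivative
      (\<lambda>h. h \<bullet> grad f w + \<mu> / 2 * ((w - v) \<bullet> h + h \<bullet> (w - v)) + z \<bullet> (A *v h)
       + \<rho> / 2 * (?r \<bullet> (A *v h) + (A *v h) \<bullet> ?r))) (at w)"
      by (rule derivative_eq_intros has_derivative_grad[OF assms] A' refl | simp)+
    moreover have "(\<lambda>h. h \<bullet> grad f w + \<mu> / 2 * ((w - v) \<bullet> h + h \<bullet> (w - v)) + z \<bullet> (A *v h)
       + \<rho> / 2 * (?r \<bullet> (A *v h) + (A *v h) \<bullet> ?r)) =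
      (\<lambda>h. h \<bullet> (grad f w + \<mu> *\<^sub>R (w - v) + transpose A *v (z + \<rho> *\<^sub>R ?r)))"
    proof
      fix h
      have "h \<bullet> (transpose A *v (z + \<rho> *\<^sub>R ?r)) = z \<bullet> (A *v h) + \<rho> * (?r \<bullet> (A *v h))"
        by (simp only: adj[symmetric] inner_add_right inner_scaleR_right inner_commute)
      then show "h \<bullet> grad f w + \<mu> / 2 * ((w - v) \<bullet> h + h \<bullet> (w - v)) + z \<bullet> (A *v h)
          + \<rho> / 2 * (?r \<bullet> (A *v h) + (A *v h) \<bullet> ?r) =
        h \<bullet> (grad f w + \<mu> *\<^sub>R (w - v) + transpose A *v (z + \<rho> *\<^sub>R ?r))"
        by (simp only: inner_add_right[of h] inner_scaleR_right inner_commute[of _ h]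
            inner_commute[of "A *v h"]) (simp add: algebra_simps)
    qed
    ultimately show ?thesis by simp
  qed
  ultimately show ?thesis unfolding grad_w_h_def by (simp add: grad_eqI)
qed

lemma lyapunov_multiplier_step:
  assumes z': "z' = z + \<rho> *\<^sub>R (A *v w + b - u)" and "\<rho> > 0"
  shows "lyapunov f A b lam \<rho> \<mu> w u z' w =
    lyapunov f A b lam \<rho> \<mu> w u z v + (norm (z' - z))\<^sup>2 / \<rho> - \<mu> / 2 * (norm (w - v))\<^sup>2"
proof -
  define r where "r = A *v w + b - u"
  have z'r: "z' = z + \<rho> *\<^sub>R r" by (simp add: z' r_def)
  have "(norm (z' - z))\<^sup>2 / \<rho> = \<rho> * (r \<bullet> r)"
    unfolding power2_norm_eq_inner using assms(2) by (simp add: z'r)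
  moreover have "z' \<bullet> r = z \<bullet> r + \<rho> * (r \<bullet> r)" by (simp add: z'r inner_add_left)
  ultimately show ?thesis by (simp add: lyapunov_def r_def[symmetric])
qed

text \<open>Completing the square in the constraint residual leaves \<open>- \<parallel>z\<parallel>\<^sup>2 / (2 \<rho>)\<close>; the square and the
  other terms besides \<open>f w\<close> are nonnegative.\<close>

lemma lyapunov_ge:
  assumes "lam \<ge> 0" "\<rho> > 0" "\<mu> \<ge> 0"
  shows "f w - (norm z)\<^sup>2 / (2 * \<rho>) \<le> lyapunov f A b lam \<rho> \<mu> w u z v"
proof -
  define r where "r = A *v w + b - u"
  have "0 \<le> (norm (z + \<rho> *\<^sub>R r))\<^sup>2 / (2 * \<rho>)" using assms by simp
  also have "\<dots> = (norm z)\<^sup>2 / (2 * \<rho>) + z \<bullet> r + \<rho> / 2 * (norm r)\<^sup>2"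
    unfolding power2_norm_eq_inner using assms
    by (simp add: inner_add_left inner_add_right inner_commute field_simps power2_eq_square)
  moreover have "0 \<le> lam * l0_norm (pos_part u)" "0 \<le> \<mu> / 2 * (norm (w - v))\<^sup>2"
    using assms by (simp_all add: l0_norm_def)
  ultimately show ?thesis by (simp add: lyapunov_def r_def)
qed

text \<open>The next two bounds start from the approximate stationarity of a primal iterate \<open>x\<close>, which
  expresses \<open>A\<^sup>T z\<close> through the gradient at \<open>x\<close>, the proximal displacement \<open>d\<close> and the error \<open>e\<close>. For
  the increment, the displacement of the second iterate is \<open>x\<^sub>2 - x\<^sub>1\<close>, so that it merges with the
  Lipschitz bound on the gradient difference.\<close>

lemma multiplier_norm_le:
  fixes A :: "real^'p^'n"
  assumes "\<And>y. \<gamma> * norm y \<le> norm (transpose A *v y)" "\<mu> \<ge> 0"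
    and "transpose A *v z = e - grad f x - \<mu> *\<^sub>R d"
  shows "\<gamma> * norm z \<le> norm e + norm (grad f x) + \<mu> * norm d"
proof -
  have "norm (y1 - y2 - y3) \<le> norm y1 + norm y2 + norm y3" for y1 y2 y3 :: "real^'p"
    by norm
  from this[of e "grad f x" "\<mu> *\<^sub>R d"] show ?thesis
    using assms(1)[of z] assms(2,3) by simp
qed

lemma multiplier_increment_le:
  fixes A :: "real^'p^'n"
  assumes "l_smooth l f" and \<gamma>_le: "\<And>y. \<gamma> * norm y \<le> norm (transpose A *v y)" and "\<mu> \<ge> 0"
    and z1: "transpose A *v z1 = e1 - grad f x1 - \<mu> *\<^sub>R d1"
    and z2: "transpose A *v z2 = e2 - grad f x2 - \<mu> *\<^sub>R (x2 - x1)"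
  shows "\<gamma> * norm (z2 - z1) \<le> (\<mu> + l) * norm (x2 - x1) + \<mu> * norm d1 + norm e2 + norm e1"
proof -
  let ?g = "grad f x2 - grad f x1"
  have g: "norm ?g \<le> l * norm (x2 - x1)"
    using assms(1) lipschitz_onD[of l UNIV "grad f"] by (simp add: l_smooth_def dist_norm)
  have "transpose A *v (z2 - z1) = e2 - e1 - ?g - \<mu> *\<^sub>R (x2 - x1) + \<mu> *\<^sub>R d1"
    by (simp add: matrix_vector_mult_diff_distrib z1 z2)
  moreover have "norm (y1 - y2 - y3 - y4 + y5) \<le> norm y1 + norm y2 + norm y3 + norm y4 + norm y5"
    for y1 y2 y3 y4 y5 :: "real^'p"
    by norm
  from this[of e2 e1 ?g "\<mu> *\<^sub>R (x2 - x1)" "\<mu> *\<^sub>R d1"]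
  have "norm (e2 - e1 - ?g - \<mu> *\<^sub>R (x2 - x1) + \<mu> *\<^sub>R d1)
      \<le> norm e2 + norm e1 + norm ?g + \<mu> * norm (x2 - x1) + \<mu> * norm d1"
    using \<open>\<mu> \<ge> 0\<close> by simp
  ultimately show ?thesis
    using \<gamma>_le[of "z2 - z1"] g by (simp add: distrib_right)
qed

text \<open>Squared and cleared of denominators, the ratio condition is exactly the conclusion; the right-hand
  side telescopes when \<open>x\<close> and \<open>y\<close> are consecutive tolerances.\<close>

lemma tolerance_step_le:
  fixes \<kappa> \<eta> x y :: real
  assumes "\<kappa> > 0" "\<eta> > 4 / \<kappa>" "x > 0" "y > 0"
    and "y / x \<le> sqrt ((\<kappa> * \<eta> - 4) / (\<kappa> * \<eta> + 4))"
  shows "4 / \<kappa> * (y\<^sup>2 + x\<^sup>2) \<le> \<eta> * (x\<^sup>2 - y\<^sup>2)"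
proof -
  define q where "q = \<kappa> * \<eta>"
  have q: "q > 4" using assms(1,2) by (simp add: q_def field_simps)
  have "(y / x)\<^sup>2 \<le> (sqrt ((q - 4) / (q + 4)))\<^sup>2"
    using assms by (intro power_mono) (auto simp: q_def)
  also have "\<dots> = (q - 4) / (q + 4)" using q by simp
  finally have "y\<^sup>2 * (q + 4) \<le> (q - 4) * x\<^sup>2"
    using q assms(3) by (simp add: power_divide field_simps)
  then have "4 * (y\<^sup>2 + x\<^sup>2) \<le> q * (x\<^sup>2 - y\<^sup>2)"
    by (simp add: algebra_simps)
  then have "4 * (y\<^sup>2 + x\<^sup>2) / \<kappa> \<le> q * (x\<^sup>2 - y\<^sup>2) / \<kappa>"
    using assms(1) by (intro divide_right_mono) auto
  then show ?thesis using assms(1) by (simp add: q_def)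
qed

section \<open>Elementary estimates\<close>

lemma square_sum3_le: "(a + b + c)\<^sup>2 \<le> 3 * (a\<^sup>2 + b\<^sup>2 + c\<^sup>2)" for a b c :: real
proof -
  have "0 \<le> (a - b)\<^sup>2 + (b - c)\<^sup>2 + (a - c)\<^sup>2" by simp
  then show ?thesis by (simp add: power2_eq_square algebra_simps)
qed

lemma square_sum4_le: "(a + b + c + d)\<^sup>2 \<le> 4 * (a\<^sup>2 + b\<^sup>2 + c\<^sup>2 + d\<^sup>2)" for a b c d :: real
proof -
  have "0 \<le> (a - b)\<^sup>2 + (b - c)\<^sup>2 + (a - c)\<^sup>2 + (a - d)\<^sup>2 + (b - d)\<^sup>2 + (c - d)\<^sup>2" by simp
  then show ?thesis by (simp add: power2_eq_square algebra_simps)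
qed

lemma bounded_range_SucD:
  assumes "bounded (range (\<lambda>k. x (Suc k)))"
  shows "bounded (range x)"
proof -
  have "range x \<subseteq> insert (x 0) (range (\<lambda>k. x (Suc k)))" by (auto, metis not0_implies_Suc rangeI)
  then show ?thesis using assms bounded_subset bounded_insert by metis
qed

section \<open>Boundedness of the iterates\<close>

theorem lemma5:
  fixes f g :: "real^'p \<Rightarrow> real" and A :: "real^'p^'n" and b :: "real^'n"
    and lam \<rho> \<mu> \<alpha> \<beta> \<eta> \<gamma> c1 c2 lf lg t :: real
    and \<epsilon> :: "nat \<Rightarrow> real" and Q :: "nat \<Rightarrow> nat \<Rightarrow> real^'p^'p"
    and w v :: "nat \<Rightarrow> real^'p" and u z :: "nat \<Rightarrow> real^'n"
  assumes f_C1: "cont_diff f"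
    and f_smooth: "l_smooth lf f"
    and f_coercive: "coercive f"
    and lam_pos: "lam > 0" and mu_pos: "\<mu> > 0" and rho_pos: "\<rho> > 0"
    and full_row_rank: "rank A = CARD('n)"
    and gamma_def: "\<gamma> = sqrt (theta_min (A ** transpose A))"
    and gamma_pos: "\<gamma> > 0"
    and c1_def: "c1 = (\<mu> + lf) / \<gamma>"
    and c2_def: "c2 = \<mu> / \<gamma>"
    and rho_large: "\<rho> > max (16 * (c1\<^sup>2 + c2\<^sup>2) / \<mu>) (6 * lf / \<gamma>\<^sup>2)"
    and alpha_def: "\<alpha> = 1 / \<rho>"
    and beta_def: "\<beta> = 8 * c2\<^sup>2 / \<rho>"
    and eta_large: "\<eta> > 4 / (\<rho> * \<gamma>\<^sup>2)"
    and eps_pos: "\<forall>k. \<epsilon> k > 0"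
    and eps_ratio: "\<forall>k. \<epsilon> (Suc k) / \<epsilon> k \<le> sqrt ((\<rho> * \<gamma>\<^sup>2 * \<eta> - 4) / (\<rho> * \<gamma>\<^sup>2 * \<eta> + 4))"
    and t_pos: "t > 0"
    and Q_psd: "\<forall>k j. sym_psd (Q k j)"
    and g_smooth: "l_smooth lg g"
    and ialm: "ialm_sequence f A b lam \<rho> \<mu> \<alpha> \<epsilon> t Q g w u z v"
  shows "bounded (range (\<lambda>k. (w k, u k, z k, v k)))"
proof -
  \<comment> \<open>\<open>v 0\<close> is arbitrary, so \<open>d 0\<close> need not be a difference of iterates. The potential \<open>E\<close> below
    therefore starts at the iterate with index 1, where \<open>v = w\<close>.\<close>
  define d where "d k = w (Suc k) - v k" for k
  define e where "e k = grad_w_h f A b \<rho> \<mu> (z k) (v k) (w (Suc k)) (u (Suc k))" for k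
  have f_diff: "f differentiable (at x)" for x
    using f_smooth by (simp add: l_smooth_def)
  have z_Suc: "z (Suc k) = z k + \<rho> *\<^sub>R (A *v w (Suc k) + b - u (Suc k))"
    and v_Suc: "v (Suc k) = w (Suc k)"
    and a: "stop_a f A b lam \<rho> \<mu> (z k) (v k) (w k) (u k) (w (Suc k)) (u (Suc k))"
    and e_le: "norm (e k) \<le> \<epsilon> k" for k
    using ialm by (auto simp: ialm_sequence_def stop_b_def e_def)
  have Az: "transpose A *v z (Suc k) = e k - grad f (w (Suc k)) - \<mu> *\<^sub>R d k" for k
    unfolding e_def grad_w_h_eq[OF f_diff] d_def z_Suc[of k] by simp
  have \<gamma>_le: "\<gamma> * norm y \<le> norm (transpose A *v y)" for y
    by (rule norm_transpose_mult_ge[OF gamma_def gamma_pos])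
  have d_Suc: "d (Suc k) = w (Suc (Suc k)) - w (Suc k)" for k
    by (simp add: d_def v_Suc)
  have \<epsilon>0: "\<epsilon> k > 0" for k using eps_pos by blast

  have dz: "norm (z (Suc (Suc k)) - z (Suc k))
      \<le> c1 * norm (d (Suc k)) + c2 * norm (d k) + \<epsilon> (Suc k) / \<gamma> + \<epsilon> k / \<gamma>" for k
  proof -
    have "transpose A *v z (Suc (Suc k)) =
        e (Suc k) - grad f (w (Suc (Suc k))) - \<mu> *\<^sub>R (w (Suc (Suc k)) - w (Suc k))"
      using Az[of "Suc k"] by (simp only: d_Suc)
    from multiplier_increment_le[OF f_smooth \<gamma>_le _ Az this]
    have "\<gamma> * norm (z (Suc (Suc k)) - z (Suc k))
        \<le> (\<mu> + lf) * norm (d (Suc k)) + \<mu> * norm (d k) + \<epsilon> (Suc k) + \<epsilon> k"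
      using e_le[of k] e_le[of "Suc k"] mu_pos by (simp add: d_Suc)
    then show ?thesis using gamma_pos unfolding c1_def c2_def by (simp add: field_simps)
  qed

  have eps_step: "4 / (\<rho> * \<gamma>\<^sup>2) * ((\<epsilon> (Suc k))\<^sup>2 + (\<epsilon> k)\<^sup>2) \<le> \<eta> * ((\<epsilon> k)\<^sup>2 - (\<epsilon> (Suc k))\<^sup>2)" for k
    using rho_pos gamma_pos eta_large \<epsilon>0 eps_ratio by (intro tolerance_step_le) auto

  define E where "E k = lyapunov f A b lam \<rho> \<mu> (w (Suc k)) (u (Suc k)) (z (Suc k)) (v (Suc k))
      + \<beta> / 2 * (norm (d k))\<^sup>2 + \<eta> * (\<epsilon> k)\<^sup>2" for k
  have E_step: "E (Suc k) \<le> E k" for k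
  proof -
    define D where "D = (norm (d (Suc k)))\<^sup>2"
    define D' where "D' = (norm (d k))\<^sup>2"
    have "(norm (z (Suc (Suc k)) - z (Suc k)))\<^sup>2
        \<le> (c1 * norm (d (Suc k)) + c2 * norm (d k) + \<epsilon> (Suc k) / \<gamma> + \<epsilon> k / \<gamma>)\<^sup>2"
      using dz by (intro power_mono) auto
    also have "\<dots> \<le> 4 * (c1\<^sup>2 * D + c2\<^sup>2 * D' + (\<epsilon> (Suc k))\<^sup>2 / \<gamma>\<^sup>2 + (\<epsilon> k)\<^sup>2 / \<gamma>\<^sup>2)"
      using square_sum4_le[of "c1 * norm (d (Suc k))" "c2 * norm (d k)" "\<epsilon> (Suc k) / \<gamma>" "\<epsilon> k / \<gamma>"]
      by (simp add: power_mult_distrib power_divide D_def D'_def)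
    finally have "(norm (z (Suc (Suc k)) - z (Suc k)))\<^sup>2 / \<rho>
        \<le> 4 * (c1\<^sup>2 * D + c2\<^sup>2 * D' + (\<epsilon> (Suc k))\<^sup>2 / \<gamma>\<^sup>2 + (\<epsilon> k)\<^sup>2 / \<gamma>\<^sup>2) / \<rho>"
      using rho_pos by (simp add: divide_right_mono)
    also have "\<dots> = 4 * c1\<^sup>2 / \<rho> * D + \<beta> / 2 * D' + 4 / (\<rho> * \<gamma>\<^sup>2) * ((\<epsilon> (Suc k))\<^sup>2 + (\<epsilon> k)\<^sup>2)"
      using rho_pos gamma_pos by (simp add: beta_def field_simps)
    also have "\<dots> \<le> 4 * c1\<^sup>2 / \<rho> * D + \<beta> / 2 * D' + \<eta> * ((\<epsilon> k)\<^sup>2 - (\<epsilon> (Suc k))\<^sup>2)"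
      using eps_step by simp
    finally have dz2: "(norm (z (Suc (Suc k)) - z (Suc k)))\<^sup>2 / \<rho>
        \<le> 4 * c1\<^sup>2 / \<rho> * D + \<beta> / 2 * D' + \<eta> * ((\<epsilon> k)\<^sup>2 - (\<epsilon> (Suc k))\<^sup>2)" .
    have "16 * (c1\<^sup>2 + c2\<^sup>2) \<le> \<rho> * \<mu>"
      using rho_large mu_pos by (simp add: field_simps)
    moreover have "0 \<le> c1\<^sup>2 + c2\<^sup>2" by simp
    ultimately have "4 * c1\<^sup>2 / \<rho> + \<beta> / 2 \<le> \<mu> / 2"
      using rho_pos mult_pos_pos[OF rho_pos mu_pos]
      unfolding beta_def by (simp add: field_simps)
    then have "(4 * c1\<^sup>2 / \<rho> + \<beta> / 2) * D \<le> \<mu> / 2 * D"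
      by (rule mult_right_mono) (simp add: D_def)
    then have "4 * c1\<^sup>2 / \<rho> * D + \<beta> / 2 * D \<le> \<mu> / 2 * D"
      by (simp only: distrib_right)
    moreover have "lyapunov f A b lam \<rho> \<mu> (w (Suc (Suc k))) (u (Suc (Suc k))) (z (Suc k)) (v (Suc k))
        \<le> lyapunov f A b lam \<rho> \<mu> (w (Suc k)) (u (Suc k)) (z (Suc k)) (v (Suc k))"
      using a[of "Suc k"] by (simp add: stop_a_def)
    moreover have "lyapunov f A b lam \<rho> \<mu> (w (Suc (Suc k))) (u (Suc (Suc k))) (z (Suc (Suc k))) (v (Suc (Suc k)))
        = lyapunov f A b lam \<rho> \<mu> (w (Suc (Suc k))) (u (Suc (Suc k))) (z (Suc k)) (v (Suc k))
          + (norm (z (Suc (Suc k)) - z (Suc k)))\<^sup>2 / \<rho> - \<mu> / 2 * D"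
      unfolding v_Suc[of "Suc k"] D_def d_def
      by (rule lyapunov_multiplier_step[OF z_Suc rho_pos])
    ultimately show ?thesis using dz2
      unfolding E_def D_def[symmetric] D'_def[symmetric] right_diff_distrib by linarith
  qed
  have E_le: "E k \<le> E 0" for k by (rule lift_Suc_antimono_le[of E]) (use E_step in auto)

  have f_cont: "continuous_on UNIV f"
    using f_diff by (intro differentiable_imp_continuous_on) (simp add: differentiable_on_def)
  obtain m where m: "m \<le> f x" for x
    using coercive_bounded_below[OF f_coercive f_cont] by blast
  \<comment> \<open>A smoothness constant exceeding \<open>lf\<close>: it is positive even if \<open>lf = 0\<close>, and it makes the gradient term
    in \<open>f_le\<close> cost exactly half of \<open>f - m\<close>.\<close>
  define L where "L = \<rho> * \<gamma>\<^sup>2 / 6"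
  have L0: "L > 0" using rho_pos gamma_pos by (simp add: L_def)
  have "l_smooth L f"
    using rho_large gamma_pos by (intro l_smooth_mono[OF f_smooth]) (simp add: L_def field_simps)
  from l_smooth_grad_norm_le[OF this L0 m]
  have grad_le: "(norm (grad f x))\<^sup>2 \<le> 2 * L * (f x - m)" for x .
  have norm_z: "\<gamma> * norm (z (Suc k)) \<le> \<epsilon> k + norm (grad f (w (Suc k))) + \<mu> * norm (d k)" for k
    using multiplier_norm_le[OF \<gamma>_le _ Az[of k]] e_le[of k] mu_pos by simp

  have f_le: "f (w (Suc k)) \<le> 2 * E 0 - m" for k
  proof -
    define F where "F = f (w (Suc k))"
    define D where "D = (norm (d k))\<^sup>2"
    have "(\<gamma> * norm (z (Suc k)))\<^sup>2 \<le> (\<epsilon> k + norm (grad f (w (Suc k))) + \<mu> * norm (d k))\<^sup>2"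
      using norm_z gamma_pos by (intro power_mono) auto
    also have "\<dots> \<le> 3 * ((\<epsilon> k)\<^sup>2 + (norm (grad f (w (Suc k))))\<^sup>2 + (\<mu> * norm (d k))\<^sup>2)"
      by (rule square_sum3_le)
    also have "\<dots> \<le> 3 * ((\<epsilon> k)\<^sup>2 + 2 * L * (F - m) + \<mu>\<^sup>2 * D)"
      using grad_le[of "w (Suc k)"] by (simp add: F_def D_def power_mult_distrib)
    finally have "(\<gamma> * norm (z (Suc k)))\<^sup>2 / (2 * \<rho> * \<gamma>\<^sup>2)
        \<le> 3 * ((\<epsilon> k)\<^sup>2 + 2 * L * (F - m) + \<mu>\<^sup>2 * D) / (2 * \<rho> * \<gamma>\<^sup>2)"
      using rho_pos by (intro divide_right_mono) auto
    also have "\<dots> = 3 / 8 * (4 / (\<rho> * \<gamma>\<^sup>2)) * (\<epsilon> k)\<^sup>2 + (F - m) / 2 + 3 / 16 * \<beta> * D"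
      using rho_pos gamma_pos by (simp add: L_def beta_def c2_def field_simps)
    also have "\<dots> \<le> \<eta> * (\<epsilon> k)\<^sup>2 + (F - m) / 2 + \<beta> / 2 * D"
    proof -
      have "0 \<le> 4 / (\<rho> * \<gamma>\<^sup>2)" using rho_pos by simp
      then have "3 / 8 * (4 / (\<rho> * \<gamma>\<^sup>2)) * (\<epsilon> k)\<^sup>2 \<le> \<eta> * (\<epsilon> k)\<^sup>2"
        using eta_large by (intro mult_right_mono) (linarith, simp)
      moreover have "0 \<le> \<beta> * D" using rho_pos by (simp add: beta_def D_def)
      ultimately show ?thesis by simp
    qed
    finally have "(norm (z (Suc k)))\<^sup>2 / (2 * \<rho>) \<le> \<eta> * (\<epsilon> k)\<^sup>2 + (F - m) / 2 + \<beta> / 2 * D"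
      using gamma_pos by (simp add: power_mult_distrib)
    moreover have "F - (norm (z (Suc k)))\<^sup>2 / (2 * \<rho>)
        \<le> lyapunov f A b lam \<rho> \<mu> (w (Suc k)) (u (Suc k)) (z (Suc k)) (v (Suc k))"
      unfolding F_def using lam_pos rho_pos mu_pos by (intro lyapunov_ge) auto
    ultimately have "F - (F - m) / 2 \<le> E k" by (simp add: E_def D_def)
    then show ?thesis using E_le[of k] by (simp add: F_def field_simps)
  qed

  have w_Suc_bd: "bounded (range (\<lambda>k. w (Suc k)))"
    by (rule bounded_subset[OF coercive_bounded_sublevel[OF f_coercive]]) (use f_le in blast)
  then have w_bd: "bounded (range w)" by (rule bounded_range_SucD)
  have v_bd: "bounded (range v)"
    by (rule bounded_range_SucD) (use w_Suc_bd in \<open>simp add: v_Suc\<close>)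
  obtain W where W: "\<And>k. norm (w k) \<le> W" using w_bd by (auto simp: bounded_iff)
  obtain V where V: "\<And>k. norm (v k) \<le> V" using v_bd by (auto simp: bounded_iff)
  have eps_le: "\<epsilon> k \<le> \<epsilon> 0" for k
  proof (rule lift_Suc_antimono_le[of \<epsilon>])
    fix n
    have pos: "0 \<le> 4 / (\<rho> * \<gamma>\<^sup>2)" using rho_pos by simp
    then have "0 \<le> 4 / (\<rho> * \<gamma>\<^sup>2) * ((\<epsilon> (Suc n))\<^sup>2 + (\<epsilon> n)\<^sup>2)"
      by (rule mult_nonneg_nonneg) simp
    then have "0 \<le> \<eta> * ((\<epsilon> n)\<^sup>2 - (\<epsilon> (Suc n))\<^sup>2)" using eps_step[of n] by linarith
    moreover have "\<eta> > 0" using pos eta_large by linarith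
    ultimately have "(\<epsilon> (Suc n))\<^sup>2 \<le> (\<epsilon> n)\<^sup>2" by (simp add: zero_le_mult_iff)
    then show "\<epsilon> (Suc n) \<le> \<epsilon> n" by (rule power2_le_imp_le) (use \<epsilon>0[of n] in simp)
  qed simp
  have z_le: "norm (z (Suc k)) \<le> (\<epsilon> 0 + sqrt (2 * L * (2 * E 0 - m - m)) + \<mu> * (W + V)) / \<gamma>" for k
  proof -
    have "(norm (grad f (w (Suc k))))\<^sup>2 \<le> 2 * L * (2 * E 0 - m - m)"
      using grad_le[of "w (Suc k)"] f_le[of k] L0
      by (smt (verit) mult_left_mono)
    then have "norm (grad f (w (Suc k))) \<le> sqrt (2 * L * (2 * E 0 - m - m))"
      by (simp add: real_le_rsqrt)
    moreover have "norm (d k) \<le> W + V"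
      using norm_triangle_ineq4[of "w (Suc k)" "v k"] W[of "Suc k"] V[of k] by (simp add: d_def)
    then have "\<mu> * norm (d k) \<le> \<mu> * (W + V)" using mu_pos by simp
    ultimately have "\<gamma> * norm (z (Suc k)) \<le> \<epsilon> 0 + sqrt (2 * L * (2 * E 0 - m - m)) + \<mu> * (W + V)"
      using norm_z[of k] eps_le[of k] by linarith
    then show ?thesis using gamma_pos by (simp add: field_simps)
  qed
  have z_Suc_bd: "bounded (range (\<lambda>k. z (Suc k)))" by (rule boundedI) (use z_le in auto)
  then have z_bd: "bounded (range z)" by (rule bounded_range_SucD)
  have u_eq: "u (Suc k) = A *v w (Suc k) + b - (1 / \<rho>) *\<^sub>R (z (Suc k) - z k)" for k
    using rho_pos by (simp add: z_Suc[of k])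
  have Aw_bd: "bounded (range (\<lambda>k. A *v w (Suc k)))"
    using bounded_linear_image[OF w_Suc_bd, of "(*v) A"] by (simp add: image_image)
  have "bounded (range (\<lambda>k. u (Suc k)))"
    unfolding u_eq
    by (intro bounded_minus_comp bounded_plus_comp bounded_scaleR_comp Aw_bd z_bd z_Suc_bd) auto
  then have u_bd: "bounded (range u)" by (rule bounded_range_SucD)
  have "range (\<lambda>k. (w k, u k, z k, v k)) \<subseteq> range w \<times> range u \<times> range z \<times> range v" by auto
  moreover have "bounded (range w \<times> range u \<times> range z \<times> range v)"
    by (intro bounded_Times w_bd u_bd z_bd v_bd)
  ultimately show ?thesis by (rule bounded_subset[rotated])
qed

end
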